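(* Let $(M,g)$ be an $n$-dimensional pseudo-Riemannian manifold and $K=\alpha v+\beta h$ a symmetric 2-tensor of type $p+q$. Then $K$ is a Killing tensor if and only if: (i) the eigenstructure $(V,H)$ is umbilical, i.e. $S_v=\frac12 v\otimes\mathbf a$ and $S_h=\frac12 h\otimes\mathbf b$ for vector fields $\mathbf a,\mathbf b$ (so $\operatorname{Tr}S_v=\frac p2\mathbf a$, $\operatorname{Tr}S_h=\frac q2\mathbf b$); and (ii) $\mathbf a=\frac{1}{\beta-\alpha}\mathrm d\alpha$ and $\mathbf b=\frac1{\alpha-\beta}\mathrm d\beta$.
   Context: Type $p+q$: $V$ is a rank-$p$ distribution on which $g$ is nondegenerate, $H=V^\perp$ (rank $q=n-p$), $v,h$ the orthogonal projectors onto $V,H$ (as covariant 2-tensors via $g$, $g=v+h$), and $\alpha\neq\beta$ are functions. Vectors and 1-forms are identified via $g$. Generalized second fundamental forms: $Q_v(x,y)=h(\nabla_{v(x)}v(y))$, $Q_h(x,y)=v(\nabla_{h(x)}h(y))$, with symmetric parts $S_v,S_h$; $(v\otimes\mathbf a)(x,y)=g(vx,vy)\mathbf a$; $\operatorname{Tr}$ is the $g$-trace over the two arguments. A Killing tensor satisfies $\nabla_{(a}K_{bc)}=0$. *)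

theory Defs
  imports "HOL-Analysis.Analysis"
begin

text \<open>Local coordinate model. The manifold is (a coordinate chart) an open set
U of real^'n; tensors are expressed in coordinates. A covariant 2-tensor field
is a matrix field A, acting as bilin A u w = u . (A w). The metric is the matrix
field G. An endomorphism field (e.g. the projector v) is a matrix field acting by *v.\<close>

definition bilin :: "real^'n^'n \<Rightarrow> real^'n \<Rightarrow> real^'n \<Rightarrow> real" where
  "bilin A u w = u \<bullet> (A *v w)"

text \<open>Directional derivative of a field F at x in direction w.\<close>
definition ddir :: "(real^'n \<Rightarrow> 'b::real_normed_vector) \<Rightarrow> real^'n \<Rightarrow> real^'n \<Rightarrow> 'b" where
  "ddir F x w = frechet_derivative F (at x) w"

text \<open>Levi-Civita connection of G via the Koszul formula:
 g(Gamma(X,Y),W) = 1/2 (dg[X](Y,W) + dg[Y](X,W) - dg[W](X,Y)).\<close>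
definition christoffel :: "(real^'n \<Rightarrow> real^'n^'n) \<Rightarrow> real^'n \<Rightarrow> real^'n \<Rightarrow> real^'n \<Rightarrow> real^'n" where
  "christoffel G x X Y = matrix_inv (G x) *v (\<chi> l. (1/2) *
      (bilin (ddir G x X) Y (axis l 1) + bilin (ddir G x Y) X (axis l 1)
       - bilin (ddir G x (axis l 1)) X Y))"

text \<open>Covariant derivative nabla_X Y at x of a vector field Yf.\<close>
definition cov_vf :: "(real^'n \<Rightarrow> real^'n^'n) \<Rightarrow> real^'n \<Rightarrow> real^'n \<Rightarrow> (real^'n \<Rightarrow> real^'n) \<Rightarrow> real^'n" where
  "cov_vf G x X Yf = ddir Yf x X + christoffel G x X (Yf x)"

text \<open>(nabla_X K)(Y,Z) at x for a covariant 2-tensor field K.\<close>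
definition cov_t2 :: "(real^'n \<Rightarrow> real^'n^'n) \<Rightarrow> (real^'n \<Rightarrow> real^'n^'n) \<Rightarrow> real^'n
     \<Rightarrow> real^'n \<Rightarrow> real^'n \<Rightarrow> real^'n \<Rightarrow> real" where
  "cov_t2 G K x X Y Z = bilin (ddir K x X) Y Z
      - bilin (K x) (christoffel G x X Y) Z - bilin (K x) Y (christoffel G x X Z)"

text \<open>Killing tensor on U: the full symmetrization of nabla_a K_bc vanishes.\<close>
definition killing :: "(real^'n \<Rightarrow> real^'n^'n) \<Rightarrow> (real^'n \<Rightarrow> real^'n^'n) \<Rightarrow> (real^'n) set \<Rightarrow> bool" where
  "killing G K U \<longleftrightarrow> (\<forall>x\<in>U. \<forall>X Y Z.
      cov_t2 G K x X Y Z + cov_t2 G K x X Z Y + cov_t2 G K x Y X Z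
    + cov_t2 G K x Y Z X + cov_t2 G K x Z X Y + cov_t2 G K x Z Y X = 0)"

text \<open>Metric g, and projectors v (matrix field P as endomorphism) and h = 1 - P.\<close>
definition ginner :: "(real^'n \<Rightarrow> real^'n^'n) \<Rightarrow> real^'n \<Rightarrow> real^'n \<Rightarrow> real^'n \<Rightarrow> real" where
  "ginner G x u w = bilin (G x) u w"

definition hproj :: "(real^'n \<Rightarrow> real^'n^'n) \<Rightarrow> real^'n \<Rightarrow> real^'n^'n" where
  "hproj P x = mat 1 - P x"

text \<open>v and h as covariant 2-tensors (lowered with g).\<close>
definition vtens :: "(real^'n \<Rightarrow> real^'n^'n) \<Rightarrow> (real^'n \<Rightarrow> real^'n^'n) \<Rightarrow> real^'n \<Rightarrow> real^'n^'n" where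
  "vtens G P x = G x ** P x"

definition htens :: "(real^'n \<Rightarrow> real^'n^'n) \<Rightarrow> (real^'n \<Rightarrow> real^'n^'n) \<Rightarrow> real^'n \<Rightarrow> real^'n^'n" where
  "htens G P x = G x ** hproj P x"

text \<open>Generalized second fundamental forms Q_v(x,y) = h(nabla_{v x} v y),
 Q_h(x,y) = v(nabla_{h x} h y) (tensorial; evaluated with x,y extended
 as constant coordinate fields), and their symmetric parts.\<close>
definition Qv where
  "Qv G P x X Y = hproj P x *v cov_vf G x (P x *v X) (\<lambda>z. P z *v Y)"

definition Qh where
  "Qh G P x X Y = P x *v cov_vf G x (hproj P x *v X) (\<lambda>z. hproj P z *v Y)"

definition Sv where
  "Sv G P x X Y = (1/2) *\<^sub>R (Qv G P x X Y + Qv G P x Y X)"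

definition Sh where
  "Sh G P x X Y = (1/2) *\<^sub>R (Qh G P x X Y + Qh G P x Y X)"

text \<open>Gradient of f (d f identified with a vector via g).\<close>
definition grad :: "(real^'n \<Rightarrow> real^'n^'n) \<Rightarrow> (real^'n \<Rightarrow> real) \<Rightarrow> real^'n \<Rightarrow> real^'n" where
  "grad G f x = matrix_inv (G x) *v (\<chi> i. ddir f x (axis i 1))"

end

theory Submission
  imports Defs
begin

text \<open>
  Let P be the projector onto V and \<nabla>P its covariant derivative. Since g is parallel,
  (\<nabla>_X K)(Y,Z) = d\<alpha>(X) v(Y,Z) + d\<beta>(X) h(Y,Z) + (\<alpha> - \<beta>) g(Y, (\<nabla>_X P) Z).
  Differentiating P^2 = P and the g-selfadjointness of P shows that \<nabla>_X P is g-selfadjoint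
  and exchanges V and H, and its two blocks are the second fundamental forms:
  h((\<nabla>_vX P) Y) = Q_v(X,Y) and v((\<nabla>_hX P) Y) = -Q_h(X,Y).
  A symmetrized trilinear form vanishes iff it vanishes on arguments of the types VVV, VVH, HHV
  and HHH. The VVV part is the symmetrization of d\<alpha> \<otimes> v on V, so by polarization it vanishes
  iff d\<alpha> \<otimes> v vanishes there; together with the VVH part, which equates 2(\<alpha> - \<beta>) S_v with
  -v \<otimes> d\<alpha> on H, this is exactly S_v = \<onehalf> v \<otimes> grad \<alpha> / (\<beta> - \<alpha>). Exchanging the roles of
  V and H gives the condition on S_h.
\<close>

subsection \<open>Symmetrized trilinear forms and orthogonal splittings\<close>

definition sym3 :: "('a \<Rightarrow> 'a \<Rightarrow> 'a \<Rightarrow> 'b::ab_semigroup_add) \<Rightarrow> 'a \<Rightarrow> 'a \<Rightarrow> 'a \<Rightarrow> 'b" where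
  "sym3 T X Y Z = T X Y Z + T X Z Y + T Y X Z + T Y Z X + T Z X Y + T Z Y X"

definition triadditive :: "('a::plus \<Rightarrow> 'a \<Rightarrow> 'a \<Rightarrow> 'b::plus) \<Rightarrow> bool" where
  "triadditive T \<longleftrightarrow> (\<forall>X X' Y Z. T (X + X') Y Z = T X Y Z + T X' Y Z)
     \<and> (\<forall>X Y Y' Z. T X (Y + Y') Z = T X Y Z + T X Y' Z)
     \<and> (\<forall>X Y Z Z'. T X Y (Z + Z') = T X Y Z + T X Y Z')"

lemma sym3_swap12: "sym3 T X Y Z = sym3 T Y X Z"
  and sym3_swap23: "sym3 T X Y Z = sym3 T X Z Y"
  by (simp_all add: sym3_def ac_simps)

lemma triadditive_sym3:
  fixes T :: "'a::plus \<Rightarrow> 'a \<Rightarrow> 'a \<Rightarrow> 'b::ab_semigroup_add"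
  assumes "triadditive T"
  shows "triadditive (sym3 T)"
  using assms unfolding triadditive_def sym3_def by (simp add: ac_simps)

lemma symmetrized_product_eq_0D:
  fixes L :: "'v::ab_group_add \<Rightarrow> real" and Q :: "'v \<Rightarrow> 'v \<Rightarrow> real"
  assumes Q_sym: "\<And>X Y. Q X Y = Q Y X" and Q_add: "\<And>X Y Z. Q (X + Y) Z = Q X Z + Q Y Z"
    and sym_zero: "\<And>X Y Z. L X * Q Y Z + L Y * Q X Z + L Z * Q X Y = 0"
  shows "L Z * Q X Y = 0"
proof (cases "L Z = 0")
  case False
  have "Q Z Z = 0"
    using sym_zero[of Z Z Z] False by simp
  then have "Q Z W = 0" for W
    using sym_zero[of Z Z W] False Q_sym[of W Z] by simp
  then have diag: "Q W W = 0" for W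
    using sym_zero[of W W Z] Q_sym[of W Z] False by simp
  have Q_add_right: "Q W (X + Y) = Q W X + Q W Y" for W X Y
    by (simp only: Q_sym[of W] Q_add)
  have "Q (X + Y) (X + Y) = Q X X + Q X Y + Q Y X + Q Y Y"
    by (simp add: Q_add Q_add_right)
  then have "Q X Y = 0"
    using diag[of "X + Y"] diag[of X] diag[of Y] Q_sym[of X Y] by simp
  then show ?thesis by simp
qed simp

locale orthogonal_splitting =
  fixes Pv Ph :: "'v::ab_group_add \<Rightarrow> 'v" and g :: "'v \<Rightarrow> 'v \<Rightarrow> real"
  assumes decomp: "X = Pv X + Ph X"
    and Pv_add: "Pv (X + Y) = Pv X + Pv Y" and Ph_add: "Ph (X + Y) = Ph X + Ph Y"
    and Pv_Ph [simp]: "Pv (Ph X) = 0" and Ph_Pv [simp]: "Ph (Pv X) = 0"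
    and g_sym: "g X Y = g Y X" and g_add: "g (X + Y) Z = g X Z + g Y Z"
    and g_orth [simp]: "g (Pv X) (Ph Y) = 0"
begin

lemma swapped_splitting: "orthogonal_splitting Ph Pv g"
proof
  show "X = Ph X + Pv X" for X
    using decomp[of X] by (simp add: add.commute)
  show "g (Ph X) (Pv Y) = 0" for X Y
    by (subst g_sym) (rule g_orth)
qed (fact Ph_add Pv_add Ph_Pv Pv_Ph g_sym g_add)+

lemma Pv_idem [simp]: "Pv (Pv X) = Pv X"
  using Pv_add[of "Pv X" "Ph X"] by (simp flip: decomp)

lemma Ph_idem [simp]: "Ph (Ph X) = Ph X"
  using Ph_add[of "Pv X" "Ph X"] by (simp flip: decomp)

lemma g_add_right: "g X (Y + Z) = g X Y + g X Z"
  by (simp only: g_sym[of X] g_add)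

lemma g_zero [simp]: "g 0 X = 0" "g X 0 = 0"
  using g_add[of 0 0 X] g_sym[of X 0] by simp_all

lemma g_orth_sym [simp]: "g (Ph X) (Pv Y) = 0"
  by (subst g_sym) (rule g_orth)

lemma sym3_eq_0_iff_components:
  fixes T :: "'v \<Rightarrow> 'v \<Rightarrow> 'v \<Rightarrow> 'b::comm_monoid_add"
  assumes "triadditive T"
  shows "(\<forall>X Y Z. sym3 T X Y Z = 0) \<longleftrightarrow>
    (\<forall>X Y Z. sym3 T (Pv X) (Pv Y) (Pv Z) = 0 \<and> sym3 T (Pv X) (Pv Y) (Ph Z) = 0
       \<and> sym3 T (Ph X) (Ph Y) (Pv Z) = 0 \<and> sym3 T (Ph X) (Ph Y) (Ph Z) = 0)"
    (is "_ \<longleftrightarrow> (\<forall>X Y Z. ?C X Y Z)")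
proof
  assume "\<forall>X Y Z. sym3 T X Y Z = 0"
  then show "\<forall>X Y Z. ?C X Y Z"
    by simp
next
  assume C: "\<forall>X Y Z. ?C X Y Z"
  let ?S = "sym3 T"
  have S_add: "?S (X + X') Y Z = ?S X Y Z + ?S X' Y Z" "?S X (Y + Y') Z = ?S X Y Z + ?S X Y' Z"
    "?S X Y (Z + Z') = ?S X Y Z + ?S X Y Z'" for X X' Y Y' Z Z'
    using triadditive_sym3[OF assms] unfolding triadditive_def by blast+
  show "\<forall>X Y Z. ?S X Y Z = 0"
  proof (intro allI)
    fix X Y Z
    have "?S (Pv X) (Ph Y) (Pv Z) = ?S (Pv X) (Pv Z) (Ph Y)"
      "?S (Ph X) (Pv Y) (Ph Z) = ?S (Ph X) (Ph Z) (Pv Y)"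
      by (rule sym3_swap23)+
    moreover have "?S (Ph X) (Pv Y) (Pv Z) = ?S (Pv Y) (Pv Z) (Ph X)"
      "?S (Pv X) (Ph Y) (Ph Z) = ?S (Ph Y) (Ph Z) (Pv X)"
      by (rule trans[OF sym3_swap12 sym3_swap23])+
    ultimately have "?S (Pv X + Ph X) (Pv Y + Ph Y) (Pv Z + Ph Z) = 0"
      unfolding S_add using C by simp
    then show "?S X Y Z = 0"
      by (simp flip: decomp)
  qed
qed

end

locale offdiagonal_forms = orthogonal_splitting Pv Ph g
  for Pv Ph :: "'v::ab_group_add \<Rightarrow> 'v" and g +
  fixes N :: "'v \<Rightarrow> 'v \<Rightarrow> 'v \<Rightarrow> real"
  assumes N_add1: "N (X + X') Y Z = N X Y Z + N X' Y Z"
    and N_add2: "N X (Y + Y') Z = N X Y Z + N X Y' Z"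
    and N_sym: "N X Y Z = N X Z Y"
    and N_Pv_Pv [simp]: "N X (Pv Y) (Pv Z) = 0" and N_Ph_Ph [simp]: "N X (Ph Y) (Ph Z) = 0"
begin

lemma swapped_forms: "offdiagonal_forms Ph Pv g N"
  using swapped_splitting
proof (rule offdiagonal_forms.intro)
  show "offdiagonal_forms_axioms Ph Pv N"
    by unfold_locales (fact N_add1 N_add2 N_sym N_Ph_Ph N_Pv_Pv)+
qed

lemma N_add3: "N X Y (Z + Z') = N X Y Z + N X Y Z'"
  by (simp only: N_sym[of X Y] N_add2)

lemma N_zero [simp]: "N 0 Y Z = 0" "N X 0 Z = 0" "N X Y 0 = 0"
  using N_add1[of 0 0 Y Z] N_add2[of X 0 0 Z] N_add3[of X Y 0 0] by simp_all

lemma N_Pv_Ph: "N X Y (Ph Z) = N X (Pv Y) (Ph Z)"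
  using N_add2[of X "Pv Y" "Ph Y" "Ph Z"] by (simp flip: decomp)

text \<open>
  The shape of \<nabla>K for K = \<alpha> v + \<beta> h, with N X Y Z standing for g(Y, (\<nabla>_X P) Z),
  d\<alpha>, d\<beta> for da, db and \<alpha> - \<beta> for c.
\<close>
definition split_tensor :: "('v \<Rightarrow> real) \<Rightarrow> ('v \<Rightarrow> real) \<Rightarrow> real \<Rightarrow> 'v \<Rightarrow> 'v \<Rightarrow> 'v \<Rightarrow> real" where
  "split_tensor da db c X Y Z = da X * g Y (Pv Z) + db X * g Y (Ph Z) + c * N X Y Z"

lemma triadditive_split_tensor:
  assumes "Modules.additive da" "Modules.additive db"
  shows "triadditive (split_tensor da db c)"
  unfolding triadditive_def split_tensor_def
  using Modules.additive.add[OF assms(1)] Modules.additive.add[OF assms(2)]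
  by (simp add: N_add1 N_add2 N_add3 g_add g_add_right Pv_add Ph_add algebra_simps)

lemma sym3_split_tensor_vvv:
  "sym3 (split_tensor da db c) (Pv X) (Pv Y) (Pv Z)
     = 2 * (da (Pv X) * g (Pv Y) (Pv Z) + da (Pv Y) * g (Pv X) (Pv Z) + da (Pv Z) * g (Pv X) (Pv Y))"
  unfolding sym3_def split_tensor_def
  using g_sym[of "Pv X" "Pv Y"] g_sym[of "Pv X" "Pv Z"] g_sym[of "Pv Y" "Pv Z"] by simp

lemma sym3_split_tensor_vvh:
  "sym3 (split_tensor da db c) (Pv X) (Pv Y) (Ph Z)
     = 2 * (c * (N (Pv X) (Pv Y) (Ph Z) + N (Pv Y) (Pv X) (Ph Z)) + da (Ph Z) * g (Pv X) (Pv Y))"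
  unfolding sym3_def split_tensor_def
  using g_sym[of "Pv X" "Pv Y"] N_sym[of "Pv X" "Ph Z" "Pv Y"] N_sym[of "Pv Y" "Ph Z" "Pv X"]
  by (simp add: algebra_simps)

lemma umbilic_iff_sym3_vvv_vvh:
  assumes "Modules.additive da"
  shows "(\<forall>X Y Z. c * (N (Pv X) (Ph Z) Y + N (Pv Y) (Ph Z) X) = - (g (Pv X) (Pv Y) * da Z)) \<longleftrightarrow>
    (\<forall>X Y Z. sym3 (split_tensor da db c) (Pv X) (Pv Y) (Pv Z) = 0
       \<and> sym3 (split_tensor da db c) (Pv X) (Pv Y) (Ph Z) = 0)"
    (is "(\<forall>X Y Z. ?U X Y Z) \<longleftrightarrow> _")
proof -
  have N_flip: "N (Pv X) (Ph Z) Y = N (Pv X) (Pv Y) (Ph Z)" for X Y Z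
    by (rule trans[OF N_sym N_Pv_Ph])
  have da_split: "da Z = da (Pv Z) + da (Ph Z)" for Z
    using Modules.additive.add[OF assms, of "Pv Z" "Ph Z"] by (simp flip: decomp)
  show ?thesis
  proof (intro iffI allI conjI)
    fix X Y Z
    assume U: "\<forall>X Y Z. ?U X Y Z"
    have vanish: "da (Pv Z) * g (Pv X) (Pv Y) = 0" for X Y Z
      using U[rule_format, where X=X and Y=Y and Z="Pv Z"] by auto
    then show "sym3 (split_tensor da db c) (Pv X) (Pv Y) (Pv Z) = 0"
      unfolding sym3_split_tensor_vvv vanish by simp
    have "c * (N (Pv X) (Pv Y) (Ph Z) + N (Pv Y) (Pv X) (Ph Z)) = - (g (Pv X) (Pv Y) * da (Ph Z))"
      using U[rule_format, where X=X and Y=Y and Z="Ph Z"] by (simp only: Ph_idem N_flip)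
    then show "sym3 (split_tensor da db c) (Pv X) (Pv Y) (Ph Z) = 0"
      unfolding sym3_split_tensor_vvh by (simp add: algebra_simps)
  next
    fix X Y Z
    assume S: "\<forall>X Y Z. sym3 (split_tensor da db c) (Pv X) (Pv Y) (Pv Z) = 0
       \<and> sym3 (split_tensor da db c) (Pv X) (Pv Y) (Ph Z) = 0"
    have sym_zero:
      "da (Pv X) * g (Pv Y) (Pv Z) + da (Pv Y) * g (Pv X) (Pv Z) + da (Pv Z) * g (Pv X) (Pv Y) = 0"
      for X Y Z
      using S[rule_format, where X=X and Y=Y and Z=Z, THEN conjunct1]
      unfolding sym3_split_tensor_vvv by simp
    have vanish: "da (Pv Z) * g (Pv X) (Pv Y) = 0"
      by (rule symmetrized_product_eq_0D[where Q="\<lambda>X Y. g (Pv X) (Pv Y)" and L="\<lambda>X. da (Pv X)",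
            OF g_sym _ sym_zero]) (simp add: Pv_add g_add)
    have "c * (N (Pv X) (Pv Y) (Ph Z) + N (Pv Y) (Pv X) (Ph Z)) + da (Ph Z) * g (Pv X) (Pv Y) = 0"
      using S[rule_format, where X=X and Y=Y and Z=Z, THEN conjunct2]
      unfolding sym3_split_tensor_vvh by simp
    with vanish show "?U X Y Z"
      unfolding N_flip da_split[of Z] by (auto simp: algebra_simps)
  qed
qed

lemma sym3_split_tensor_eq_0_iff:
  assumes da: "Modules.additive da" and db: "Modules.additive db"
  shows "(\<forall>X Y Z. sym3 (split_tensor da db c) X Y Z = 0) \<longleftrightarrow>
    (\<forall>X Y Z. c * (N (Pv X) (Ph Z) Y + N (Pv Y) (Ph Z) X) = - (g (Pv X) (Pv Y) * da Z)) \<and>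
    (\<forall>X Y Z. c * (N (Ph X) (Pv Z) Y + N (Ph Y) (Pv Z) X) = - (g (Ph X) (Ph Y) * db Z))"
proof -
  interpret swapped: offdiagonal_forms Ph Pv g N
    by (rule swapped_forms)
  have swap_eq: "swapped.split_tensor db da c = split_tensor da db c"
    unfolding swapped.split_tensor_def split_tensor_def by (simp add: fun_eq_iff algebra_simps)
  have umbilic_h:
    "(\<forall>X Y Z. c * (N (Ph X) (Pv Z) Y + N (Ph Y) (Pv Z) X) = - (g (Ph X) (Ph Y) * db Z)) \<longleftrightarrow>
     (\<forall>X Y Z. sym3 (split_tensor da db c) (Ph X) (Ph Y) (Ph Z) = 0
        \<and> sym3 (split_tensor da db c) (Ph X) (Ph Y) (Pv Z) = 0)"
    unfolding swap_eq[symmetric] by (rule swapped.umbilic_iff_sym3_vvv_vvh[OF db])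
  show ?thesis
    unfolding sym3_eq_0_iff_components[OF triadditive_split_tensor[OF da db]]
      umbilic_iff_sym3_vvv_vvh[OF da, where db=db] umbilic_h
    by blast
qed

end

subsection \<open>Matrix algebra\<close>

lemma bounded_bilinear_matrix_matrix_mult:
  "bounded_bilinear ((**) :: real^'n^'m \<Rightarrow> real^'k^'n \<Rightarrow> real^'k^'m)"
proof -
  have "bilinear ((**) :: real^'n^'m \<Rightarrow> real^'k^'n \<Rightarrow> real^'k^'m)"
    unfolding bilinear_def
    by (auto intro!: linearI simp: matrix_matrix_mult_def vec_eq_iff sum_distrib_left algebra_simps sum.distrib)
  then show ?thesis
    by (rule bilinear_conv_bounded_bilinear[THEN iffD1])
qed

lemma bounded_linear_transpose: "bounded_linear (transpose :: real^'n^'m \<Rightarrow> real^'m^'n)"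
  unfolding linear_conv_bounded_linear[symmetric]
  by (auto intro!: linearI simp: transpose_def vec_eq_iff)

lemma bounded_linear_matrix_vector_mult_left:
  "bounded_linear (\<lambda>A::real^'n^'m. A *v w)"
  unfolding linear_conv_bounded_linear[symmetric]
  by (auto intro!: linearI simp: matrix_vector_mult_def vec_eq_iff sum_distrib_left algebra_simps sum.distrib)

lemma matrix_vector_mult_scaleR_left: "(r *\<^sub>R A) *v w = r *\<^sub>R (A *v w :: real^'m)"
  by (simp add: scaleR_matrix_vector_assoc)

lemma matrix_vector_mult_uminus_left: "(- A) *v w = - (A *v w :: real^'m)"
  by (simp add: matrix_vector_mult_def vec_eq_iff sum_negf)

lemma matrix_vector_mult_uminus_right: "A *v (- w) = - (A *v w :: real^'m)"
  by (metis diff_0 matrix_vector_mult_diff_distrib matrix_vector_mult_0_right)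

lemma matrix_inv_right: "invertible A \<Longrightarrow> A ** matrix_inv A = mat 1"
  unfolding invertible_def matrix_inv_def by (metis (mono_tags, lifting) someI_ex)

lemma inner_chi_linear:
  assumes "linear f"
  shows "w \<bullet> (\<chi> l. f (axis l 1)) = f (w :: real^'n)"
proof -
  have "f w = f (\<Sum>l\<in>UNIV. w$l *\<^sub>R axis l 1)"
    using basis_expansion[of w] by (simp add: scalar_mult_eq_scaleR)
  also have "\<dots> = (\<Sum>l\<in>UNIV. w$l * f (axis l 1))"
    using assms by (simp add: linear_sum linear_scale)
  finally show ?thesis
    by (simp add: inner_vec_def)
qed

lemma bilin_simps:
  fixes A B :: "real^'n^'n"
  shows "bilin A (u + v) w = bilin A u w + bilin A v w"
    "bilin A u (v + w) = bilin A u v + bilin A u w"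
    "bilin A (u - v) w = bilin A u w - bilin A v w"
    "bilin A u (v - w) = bilin A u v - bilin A u w"
    "bilin A (r *\<^sub>R u) w = r * bilin A u w"
    "bilin A u (r *\<^sub>R w) = r * bilin A u w"
    "bilin A (- u) w = - bilin A u w"
    "bilin A u (- w) = - bilin A u w"
    "bilin A 0 w = 0" "bilin A u 0 = 0"
    "bilin (A + B) u w = bilin A u w + bilin B u w"
    "bilin (A - B) u w = bilin A u w - bilin B u w"
    "bilin (r *\<^sub>R A) u w = r * bilin A u w"
    "bilin (- A) u w = - bilin A u w"
    "bilin (A ** B) u w = bilin A u (B *v w)"
  by (simp_all add: bilin_def algebra_simps matrix_vector_mul_assoc
      matrix_vector_mult_scaleR_left matrix_vector_mult_uminus_left matrix_vector_mult_uminus_right)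

lemma bilin_transpose: "bilin (transpose A) w u = bilin A u w"
  unfolding bilin_def by (metis dot_lmul_matrix inner_commute transpose_matrix_vector)

lemma bilin_sym: "transpose A = A \<Longrightarrow> bilin A u w = bilin A w u"
  by (metis bilin_transpose)

lemma bilin_matrix_inv:
  assumes "transpose A = A" "invertible A"
  shows "bilin A (matrix_inv A *v v) w = w \<bullet> v"
proof -
  have "bilin A (matrix_inv A *v v) w = bilin A w (matrix_inv A *v v)"
    by (rule bilin_sym[OF assms(1)])
  then show ?thesis
    by (simp add: bilin_def matrix_vector_mul_assoc matrix_inv_right[OF assms(2)])
qed

lemma bilin_nondegenerate:
  assumes "invertible A" and "\<And>w. bilin A u w = bilin A u' w"
  shows "u = u'"
proof -
  have "bilin A (u - u') (matrix_inv A *v (u - u')) = 0"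
    using assms(2) by (simp add: bilin_simps)
  then have "(u - u') \<bullet> (u - u') = 0"
    unfolding bilin_def by (simp add: matrix_vector_mul_assoc matrix_inv_right[OF assms(1)])
  then show ?thesis by simp
qed

lemma ginner_simps:
  "ginner G x (u + v) w = ginner G x u w + ginner G x v w"
  "ginner G x u (v + w) = ginner G x u v + ginner G x u w"
  "ginner G x (u - v) w = ginner G x u w - ginner G x v w"
  "ginner G x u (v - w) = ginner G x u v - ginner G x u w"
  "ginner G x (r *\<^sub>R u) w = r * ginner G x u w"
  "ginner G x u (r *\<^sub>R w) = r * ginner G x u w"
  "ginner G x (- u) w = - ginner G x u w"
  "ginner G x u (- w) = - ginner G x u w"
  "ginner G x 0 w = 0" "ginner G x u 0 = 0"
  by (simp_all add: ginner_def bilin_simps)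

lemma hproj_apply: "hproj P x *v v = v - P x *v v"
  by (simp add: hproj_def matrix_vector_mult_diff_rdistrib)

subsection \<open>Directional derivatives\<close>

lemma has_derivative_ddir: "F differentiable at x \<Longrightarrow> (F has_derivative ddir F x) (at x)"
  unfolding ddir_def[abs_def] by (simp add: frechet_derivative_works[symmetric])

lemma linear_ddir: "F differentiable at x \<Longrightarrow> linear (ddir F x)"
  unfolding ddir_def[abs_def] by (rule linear_frechet_derivative)

lemma additive_ddir: "F differentiable at x \<Longrightarrow> Modules.additive (ddir F x)"
  by (rule Modules.additive.intro) (simp add: linear_add linear_ddir)

lemma ddir_eqI: "(F has_derivative F') (at x) \<Longrightarrow> ddir F x = F'"
  unfolding ddir_def[abs_def] by (metis frechet_derivative_at)

lemma ddir_cong_open: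
  assumes "F differentiable at x" "open U" "x \<in> U" "\<And>z. z \<in> U \<Longrightarrow> F z = H z"
  shows "ddir F x = ddir H x"
  unfolding ddir_def[abs_def] using frechet_derivative_transform_within_open[OF assms] by simp

lemma has_derivative_matrix_mult:
  assumes "A differentiable at x" "B differentiable at x"
  shows "((\<lambda>z. A z ** B z :: real^'n^'n) has_derivative (\<lambda>X. A x ** ddir B x X + ddir A x X ** B x)) (at x)"
  by (rule bounded_bilinear.FDERIV[OF bounded_bilinear_matrix_matrix_mult
        has_derivative_ddir[OF assms(1)] has_derivative_ddir[OF assms(2)]])

lemma ddir_matrix_mult:
  assumes "A differentiable at x" "B differentiable at x"
  shows "ddir (\<lambda>z. A z ** B z :: real^'n^'n) x X = A x ** ddir B x X + ddir A x X ** B x"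
  using ddir_eqI[OF has_derivative_matrix_mult[OF assms]] by simp

lemma ddir_matrix_vector_mult:
  assumes "A differentiable at x"
  shows "ddir (\<lambda>z. A z *v w) x X = ddir A x X *v (w :: real^'n)"
  using ddir_eqI[OF bounded_linear.has_derivative[OF bounded_linear_matrix_vector_mult_left[of w]
        has_derivative_ddir[OF assms]]]
  by simp

lemma ddir_transpose:
  assumes "A differentiable at x"
  shows "ddir (\<lambda>z. transpose (A z) :: real^'n^'n) x X = transpose (ddir A x X)"
  using ddir_eqI[OF bounded_linear.has_derivative[OF bounded_linear_transpose has_derivative_ddir[OF assms]]]
  by simp

lemma ddir_symmetric:
  assumes "A differentiable at x" "open U" "x \<in> U" "\<And>z. z \<in> U \<Longrightarrow> transpose (A z) = A z"
  shows "transpose (ddir A x X) = (ddir A x X :: real^'n^'n)"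
  using ddir_cong_open[OF assms(1-3), of "\<lambda>z. transpose (A z)"] assms(4) ddir_transpose[OF assms(1)]
  by metis

lemma hproj_differentiable: "P differentiable at x \<Longrightarrow> hproj P differentiable at x"
  unfolding hproj_def[abs_def] by simp

lemma ddir_hproj: "P differentiable at x \<Longrightarrow> ddir (hproj P) x X = - ddir P x X"
  unfolding hproj_def[abs_def]
  using ddir_eqI[OF has_derivative_diff[OF has_derivative_const has_derivative_ddir], of P x "mat 1"]
  by simp

lemma ddir_scaleR_add:
  assumes "f differentiable at x" "k differentiable at x" "A differentiable at x" "B differentiable at x"
  shows "ddir (\<lambda>z. f z *\<^sub>R A z + k z *\<^sub>R B z) x X
    = f x *\<^sub>R ddir A x X + ddir f x X *\<^sub>R A x + (k x *\<^sub>R ddir B x X + ddir k x X *\<^sub>R B x)"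
  using ddir_eqI[OF has_derivative_add[OF
        has_derivative_scaleR[OF has_derivative_ddir[OF assms(1)] has_derivative_ddir[OF assms(3)]]
        has_derivative_scaleR[OF has_derivative_ddir[OF assms(2)] has_derivative_ddir[OF assms(4)]]]]
  by simp

lemma cov_t2_scaleR_add:
  assumes "f differentiable at x" "k differentiable at x" "A differentiable at x" "B differentiable at x"
  shows "cov_t2 G (\<lambda>z. f z *\<^sub>R A z + k z *\<^sub>R B z) x X Y Z
    = ddir f x X * bilin (A x) Y Z + f x * cov_t2 G A x X Y Z
      + ddir k x X * bilin (B x) Y Z + k x * cov_t2 G B x X Y Z"
  unfolding cov_t2_def ddir_scaleR_add[OF assms] by (simp add: bilin_simps algebra_simps)

subsection \<open>The Levi-Civita connection in a chart\<close>

locale metric_chart =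
  fixes G :: "real^'n \<Rightarrow> real^'n^'n" and U :: "(real^'n) set"
  assumes open_chart: "open U"
    and metric_symmetric: "x \<in> U \<Longrightarrow> transpose (G x) = G x"
    and metric_invertible: "x \<in> U \<Longrightarrow> invertible (G x)"
    and metric_differentiable: "x \<in> U \<Longrightarrow> G differentiable at x"
begin

context
  fixes x assumes x: "x \<in> U"
begin

lemma ginner_sym: "ginner G x u w = ginner G x w u"
  unfolding ginner_def by (rule bilin_sym[OF metric_symmetric[OF x]])

lemma vector_eq_iff_ginner: "u = w \<longleftrightarrow> (\<forall>Z. ginner G x u Z = ginner G x w Z)"
  using bilin_nondegenerate[OF metric_invertible[OF x]] unfolding ginner_def by auto

lemma christoffel_koszul:
  "ginner G x (christoffel G x X Y) W
     = 1/2 * (bilin (ddir G x X) Y W + bilin (ddir G x Y) X W - bilin (ddir G x W) X Y)"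
proof -
  have "linear (\<lambda>W. 1/2 * (bilin (ddir G x X) Y W + bilin (ddir G x Y) X W - bilin (ddir G x W) X Y))"
    using linear_ddir[OF metric_differentiable[OF x]]
    by (intro linearI) (simp_all add: bilin_simps linear_add linear_scale algebra_simps)
  from inner_chi_linear[OF this, of W] show ?thesis
    unfolding christoffel_def ginner_def bilin_matrix_inv[OF metric_symmetric[OF x] metric_invertible[OF x]]
    by simp
qed

lemma metric_compatible:
  "bilin (ddir G x X) Y W = ginner G x (christoffel G x X Y) W + ginner G x Y (christoffel G x X W)"
  using christoffel_koszul[of X Y W] christoffel_koszul[of X W Y] ginner_sym[of Y]
    bilin_sym[OF ddir_symmetric[OF metric_differentiable[OF x] open_chart x metric_symmetric], of X Y W]
  by (simp add: algebra_simps)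

lemma christoffel_add_left: "christoffel G x (X + X') Y = christoffel G x X Y + christoffel G x X' Y"
  and christoffel_add_right: "christoffel G x X (Y + Y') = christoffel G x X Y + christoffel G x X Y'"
  and christoffel_diff_right: "christoffel G x X (Y - Y') = christoffel G x X Y - christoffel G x X Y'"
  using linear_ddir[OF metric_differentiable[OF x]]
  by (simp_all add: vector_eq_iff_ginner ginner_simps christoffel_koszul bilin_simps
      linear_add linear_diff algebra_simps)

lemma christoffel_zero_right [simp]: "christoffel G x X 0 = 0"
  using christoffel_add_right[of X 0 0] by simp

lemma ginner_grad: "f differentiable at x \<Longrightarrow> ginner G x (grad G f x) Z = ddir f x Z"
  unfolding grad_def ginner_def bilin_matrix_inv[OF metric_symmetric[OF x] metric_invertible[OF x]]
  by (simp add: inner_chi_linear linear_ddir)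

lemma cov_t2_symmetric:
  assumes "K differentiable at x" "\<And>z. z \<in> U \<Longrightarrow> transpose (K z) = K z"
  shows "cov_t2 G K x X Y Z = cov_t2 G K x X Z Y"
  unfolding cov_t2_def
  using bilin_sym[OF ddir_symmetric[OF assms(1) open_chart x assms(2)], of X Y Z]
    bilin_sym[OF assms(2)[OF x]]
  by simp

end

end


subsection \<open>The covariant derivative of the projector\<close>

definition cov_endo ::
    "(real^'n \<Rightarrow> real^'n^'n) \<Rightarrow> (real^'n \<Rightarrow> real^'n^'n) \<Rightarrow> real^'n \<Rightarrow> real^'n \<Rightarrow> real^'n \<Rightarrow> real^'n" where
  "cov_endo G F x X Z = ddir F x X *v Z + christoffel G x X (F x *v Z) - F x *v christoffel G x X Z"

locale projector_chart = metric_chart G U for G :: "real^'n \<Rightarrow> real^'n^'n" and U +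
  fixes P :: "real^'n \<Rightarrow> real^'n^'n"
  assumes proj_idem: "x \<in> U \<Longrightarrow> P x ** P x = P x"
    and proj_selfadjoint: "x \<in> U \<Longrightarrow> transpose (G x ** P x) = G x ** P x"
    and proj_differentiable: "x \<in> U \<Longrightarrow> P differentiable at x"
begin

context
  fixes x assumes x: "x \<in> U"
begin

lemma proj_proj [simp]: "P x *v (P x *v v) = P x *v v"
  using proj_idem[OF x] by (simp add: matrix_vector_mul_assoc)

lemma proj_hproj [simp]: "P x *v (hproj P x *v v) = 0"
  and hproj_proj [simp]: "hproj P x *v (P x *v v) = 0"
  by (simp_all add: hproj_apply matrix_vector_mult_diff_distrib)

lemma ginner_proj_swap: "ginner G x u (P x *v w) = ginner G x (P x *v u) w"
proof -
  have "ginner G x u (P x *v w) = bilin (G x ** P x) u w"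
    by (simp add: ginner_def bilin_simps)
  also have "\<dots> = bilin (G x ** P x) w u"
    by (rule bilin_sym[OF proj_selfadjoint[OF x]])
  also have "\<dots> = ginner G x (P x *v u) w"
    using ginner_sym[OF x] by (simp add: ginner_def bilin_simps)
  finally show ?thesis .
qed

lemma ginner_hproj_swap: "ginner G x u (hproj P x *v w) = ginner G x (hproj P x *v u) w"
  using ginner_proj_swap[of u w] ginner_sym[OF x, of u w] by (simp add: hproj_apply ginner_simps)

lemma vtens_differentiable: "vtens G P differentiable at x"
  and htens_differentiable: "htens G P differentiable at x"
  unfolding vtens_def[abs_def] htens_def[abs_def]
  by (intro differentiableI[OF has_derivative_matrix_mult] metric_differentiable[OF x]
      proj_differentiable[OF x] hproj_differentiable)+

lemma cov_t2_vtens: "cov_t2 G (vtens G P) x X Y Z = ginner G x Y (cov_endo G P x X Z)"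
  unfolding cov_t2_def vtens_def[abs_def]
    ddir_matrix_mult[OF metric_differentiable[OF x] proj_differentiable[OF x]]
  by (simp add: bilin_simps metric_compatible[OF x] cov_endo_def ginner_simps ginner_def)

lemma cov_t2_htens: "cov_t2 G (htens G P) x X Y Z = - ginner G x Y (cov_endo G P x X Z)"
  unfolding cov_t2_def htens_def[abs_def]
    ddir_matrix_mult[OF metric_differentiable[OF x] hproj_differentiable[OF proj_differentiable[OF x]]]
    ddir_hproj[OF proj_differentiable[OF x]]
  by (simp add: bilin_simps metric_compatible[OF x] cov_endo_def ginner_simps hproj_apply
      christoffel_diff_right[OF x] matrix_vector_mult_uminus_left ginner_def)

lemma ddir_proj_idem: "ddir P x X ** P x + P x ** ddir P x X = ddir P x X"
proof -
  have "ddir (\<lambda>z. P z ** P z) x = ddir P x"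
    by (rule ddir_cong_open[OF differentiableI[OF has_derivative_matrix_mult] open_chart x])
      (simp_all add: proj_differentiable[OF x] proj_idem)
  then show ?thesis
    using ddir_matrix_mult[OF proj_differentiable[OF x] proj_differentiable[OF x], of X]
    by (simp add: add.commute)
qed

lemma proj_ddir_proj [simp]: "P x *v (ddir P x X *v (P x *v v)) = 0"
  using arg_cong[OF ddir_proj_idem, of "\<lambda>M. M *v (P x *v v)", of X]
  by (simp add: matrix_vector_mult_add_rdistrib matrix_vector_mul_assoc[symmetric])

lemma hproj_ddir_hproj [simp]: "hproj P x *v (ddir P x X *v (hproj P x *v v)) = 0"
  using arg_cong[OF ddir_proj_idem, of "\<lambda>M. M *v v", of X] proj_ddir_proj[of X v]
  by (simp add: hproj_apply matrix_vector_mul_assoc[symmetric] algebra_simps)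

lemma cov_endo_selfadjoint: "ginner G x Y (cov_endo G P x X Z) = ginner G x Z (cov_endo G P x X Y)"
  using cov_t2_symmetric[OF x vtens_differentiable, of X Y Z] proj_selfadjoint
  by (simp add: cov_t2_vtens vtens_def)

lemma cov_endo_add_left: "cov_endo G P x (X + X') Z = cov_endo G P x X Z + cov_endo G P x X' Z"
  using linear_add[OF linear_ddir[OF proj_differentiable[OF x]]]
  by (simp add: cov_endo_def christoffel_add_left[OF x] algebra_simps)

lemma proj_cov_endo_proj: "P x *v cov_endo G P x X (P x *v Z) = 0"
  by (simp add: cov_endo_def matrix_vector_right_distrib matrix_vector_mult_diff_distrib)

lemma hproj_cov_endo_hproj: "hproj P x *v cov_endo G P x X (hproj P x *v Z) = 0"
  by (simp add: cov_endo_def matrix_vector_right_distrib matrix_vector_mult_diff_distrib christoffel_zero_right[OF x])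

lemma Qv_eq_cov_endo: "Qv G P x X Y = hproj P x *v cov_endo G P x (P x *v X) Y"
  by (simp add: Qv_def cov_vf_def cov_endo_def ddir_matrix_vector_mult[OF proj_differentiable[OF x]]
      matrix_vector_right_distrib matrix_vector_mult_diff_distrib)

lemma Qh_eq_cov_endo: "Qh G P x X Y = - (P x *v cov_endo G P x (hproj P x *v X) Y)"
  unfolding Qh_def cov_vf_def ddir_matrix_vector_mult[OF hproj_differentiable[OF proj_differentiable[OF x]]]
    ddir_hproj[OF proj_differentiable[OF x]]
  by (simp add: cov_endo_def matrix_vector_mult_uminus_left matrix_vector_mult_uminus_right
      matrix_vector_right_distrib matrix_vector_mult_diff_distrib hproj_apply christoffel_diff_right[OF x])

lemma offdiagonal_forms_cov_endo:
  "offdiagonal_forms ((*v) (P x)) ((*v) (hproj P x)) (ginner G x)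
     (\<lambda>X Y Z. ginner G x Y (cov_endo G P x X Z))"
proof unfold_locales
  fix X Y Z X' Y' :: "real^'n"
  show "X = P x *v X + hproj P x *v X"
    by (simp add: hproj_apply)
  show "P x *v (X + Y) = P x *v X + P x *v Y" "hproj P x *v (X + Y) = hproj P x *v X + hproj P x *v Y"
    by (simp_all add: matrix_vector_right_distrib)
  show "ginner G x X Y = ginner G x Y X"
    by (rule ginner_sym[OF x])
  show "ginner G x (P x *v X) (hproj P x *v Y) = 0"
    by (simp add: ginner_proj_swap[symmetric] ginner_simps)
  show "ginner G x Y (cov_endo G P x (X + X') Z)
      = ginner G x Y (cov_endo G P x X Z) + ginner G x Y (cov_endo G P x X' Z)"
    by (simp add: cov_endo_add_left ginner_simps)
  show "ginner G x Y (cov_endo G P x X Z) = ginner G x Z (cov_endo G P x X Y)"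
    by (rule cov_endo_selfadjoint)
  show "ginner G x (P x *v Y) (cov_endo G P x X (P x *v Z)) = 0"
    by (simp add: ginner_proj_swap[symmetric] proj_cov_endo_proj ginner_simps)
  show "ginner G x (hproj P x *v Y) (cov_endo G P x X (hproj P x *v Z)) = 0"
    by (simp add: ginner_hproj_swap[symmetric] hproj_cov_endo_hproj ginner_simps)
qed (simp_all add: ginner_simps)

lemma ginner_Sv:
  "ginner G x (Sv G P x X Y) Z = 1/2 * (ginner G x (hproj P x *v Z) (cov_endo G P x (P x *v X) Y)
     + ginner G x (hproj P x *v Z) (cov_endo G P x (P x *v Y) X))"
proof -
  have "ginner G x (Qv G P x X Y) Z = ginner G x (hproj P x *v Z) (cov_endo G P x (P x *v X) Y)" for X Y
    by (metis Qv_eq_cov_endo ginner_hproj_swap ginner_sym[OF x])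
  then show ?thesis
    by (simp add: Sv_def ginner_simps)
qed

lemma ginner_Sh:
  "ginner G x (Sh G P x X Y) Z = - (1/2 * (ginner G x (P x *v Z) (cov_endo G P x (hproj P x *v X) Y)
     + ginner G x (P x *v Z) (cov_endo G P x (hproj P x *v Y) X)))"
proof -
  have "ginner G x (Qh G P x X Y) Z = - ginner G x (P x *v Z) (cov_endo G P x (hproj P x *v X) Y)" for X Y
    by (metis Qh_eq_cov_endo ginner_proj_swap ginner_sym[OF x] ginner_simps(7))
  then show ?thesis
    by (simp add: Sh_def ginner_simps algebra_simps)
qed

lemma umbilic_Sv_iff:
  assumes \<alpha>: "\<alpha> differentiable at x" and \<alpha>\<beta>: "\<alpha> x \<noteq> \<beta> x"
  shows "(\<forall>X Y. Sv G P x X Y = ((1/2) * ginner G x (P x *v X) (P x *v Y)) *\<^sub>R ((1 / (\<beta> x - \<alpha> x)) *\<^sub>R grad G \<alpha> x))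
    \<longleftrightarrow> (\<forall>X Y Z. (\<alpha> x - \<beta> x) * (ginner G x (hproj P x *v Z) (cov_endo G P x (P x *v X) Y)
           + ginner G x (hproj P x *v Z) (cov_endo G P x (P x *v Y) X))
         = - (ginner G x (P x *v X) (P x *v Y) * ddir \<alpha> x Z))"
proof -
  have scale: "1/2 * A = 1/2 * q * (1 / (\<beta> x - \<alpha> x) * d) \<longleftrightarrow> (\<alpha> x - \<beta> x) * A = - (q * d)"
    for A q d :: real
    using \<alpha>\<beta> by (auto simp: field_simps)
  show ?thesis
    unfolding vector_eq_iff_ginner[OF x] ginner_Sv ginner_simps ginner_grad[OF x \<alpha>] scale ..
qed

lemma umbilic_Sh_iff:
  assumes \<beta>: "\<beta> differentiable at x" and \<alpha>\<beta>: "\<alpha> x \<noteq> \<beta> x"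
  shows "(\<forall>X Y. Sh G P x X Y = ((1/2) * ginner G x (hproj P x *v X) (hproj P x *v Y)) *\<^sub>R ((1 / (\<alpha> x - \<beta> x)) *\<^sub>R grad G \<beta> x))
    \<longleftrightarrow> (\<forall>X Y Z. (\<alpha> x - \<beta> x) * (ginner G x (P x *v Z) (cov_endo G P x (hproj P x *v X) Y)
           + ginner G x (P x *v Z) (cov_endo G P x (hproj P x *v Y) X))
         = - (ginner G x (hproj P x *v X) (hproj P x *v Y) * ddir \<beta> x Z))"
proof -
  have scale: "- (1/2 * A) = 1/2 * q * (1 / (\<alpha> x - \<beta> x) * d) \<longleftrightarrow> (\<alpha> x - \<beta> x) * A = - (q * d)"
    for A q d :: real
    using \<alpha>\<beta> by (auto simp: field_simps)
  show ?thesis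
    unfolding vector_eq_iff_ginner[OF x] ginner_Sh ginner_simps ginner_grad[OF x \<beta>] scale ..
qed

lemma sym3_cov_t2_eq_0_iff_umbilic:
  assumes \<alpha>: "\<alpha> differentiable at x" and \<beta>: "\<beta> differentiable at x" and \<alpha>\<beta>: "\<alpha> x \<noteq> \<beta> x"
  shows "(\<forall>X Y Z. sym3 (cov_t2 G (\<lambda>z. \<alpha> z *\<^sub>R vtens G P z + \<beta> z *\<^sub>R htens G P z) x) X Y Z = 0) \<longleftrightarrow>
    (\<forall>X Y. Sv G P x X Y = ((1/2) * ginner G x (P x *v X) (P x *v Y)) *\<^sub>R ((1 / (\<beta> x - \<alpha> x)) *\<^sub>R grad G \<alpha> x)) \<and>
    (\<forall>X Y. Sh G P x X Y = ((1/2) * ginner G x (hproj P x *v X) (hproj P x *v Y)) *\<^sub>R ((1 / (\<alpha> x - \<beta> x)) *\<^sub>R grad G \<beta> x))"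
proof -
  interpret S: offdiagonal_forms "(*v) (P x)" "(*v) (hproj P x)" "ginner G x"
      "\<lambda>X Y Z. ginner G x Y (cov_endo G P x X Z)"
    by (rule offdiagonal_forms_cov_endo)
  have "cov_t2 G (\<lambda>z. \<alpha> z *\<^sub>R vtens G P z + \<beta> z *\<^sub>R htens G P z) x
      = S.split_tensor (ddir \<alpha> x) (ddir \<beta> x) (\<alpha> x - \<beta> x)"
  proof (intro ext)
    fix X Y Z
    show "cov_t2 G (\<lambda>z. \<alpha> z *\<^sub>R vtens G P z + \<beta> z *\<^sub>R htens G P z) x X Y Z
      = S.split_tensor (ddir \<alpha> x) (ddir \<beta> x) (\<alpha> x - \<beta> x) X Y Z"
      unfolding cov_t2_scaleR_add[OF \<alpha> \<beta> vtens_differentiable htens_differentiable]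
        cov_t2_vtens cov_t2_htens S.split_tensor_def
      by (simp add: vtens_def htens_def ginner_def bilin_simps algebra_simps)
  qed
  then show ?thesis
    using S.sym3_split_tensor_eq_0_iff[where c="\<alpha> x - \<beta> x", OF additive_ddir[OF \<alpha>] additive_ddir[OF \<beta>]]
    unfolding umbilic_Sv_iff[where \<alpha>=\<alpha> and \<beta>=\<beta>, OF \<alpha> \<alpha>\<beta>]
      umbilic_Sh_iff[where \<alpha>=\<alpha> and \<beta>=\<beta>, OF \<beta> \<alpha>\<beta>]
    by simp
qed

end

end


theorem proposition2:
  fixes G P :: "real^'n \<Rightarrow> real^'n^'n"
    and \<alpha> \<beta> :: "real^'n \<Rightarrow> real"
    and U :: "(real^'n) set" and p :: nat
  assumes "open U"
    and "\<forall>x\<in>U. transpose (G x) = G x \<and> invertible (G x)"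
    and "\<forall>x\<in>U. P x ** P x = P x \<and> transpose (G x ** P x) = G x ** P x \<and> rank (P x) = p"
    and "\<forall>x\<in>U. G differentiable at x \<and> P differentiable at x
               \<and> \<alpha> differentiable at x \<and> \<beta> differentiable at x"
    and "\<forall>x\<in>U. \<alpha> x \<noteq> \<beta> x"
  shows "killing G (\<lambda>x. \<alpha> x *\<^sub>R vtens G P x + \<beta> x *\<^sub>R htens G P x) U
     \<longleftrightarrow> (\<exists>a b :: real^'n \<Rightarrow> real^'n. \<forall>x\<in>U.
            (\<forall>X Y. Sv G P x X Y = ((1/2) * ginner G x (P x *v X) (P x *v Y)) *\<^sub>R a x)
          \<and> (\<forall>X Y. Sh G P x X Y = ((1/2) * ginner G x (hproj P x *v X) (hproj P x *v Y)) *\<^sub>R b x)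
          \<and> a x = (1 / (\<beta> x - \<alpha> x)) *\<^sub>R grad G \<alpha> x
          \<and> b x = (1 / (\<alpha> x - \<beta> x)) *\<^sub>R grad G \<beta> x)"
proof -
  interpret projector_chart G U P
    using assms(1-4) by unfold_locales auto
  let ?K = "\<lambda>x. \<alpha> x *\<^sub>R vtens G P x + \<beta> x *\<^sub>R htens G P x"
  have "killing G ?K U \<longleftrightarrow> (\<forall>x\<in>U. \<forall>X Y Z. sym3 (cov_t2 G ?K x) X Y Z = 0)"
    unfolding killing_def sym3_def ..
  also have "\<dots> \<longleftrightarrow> (\<forall>x\<in>U.
      (\<forall>X Y. Sv G P x X Y = ((1/2) * ginner G x (P x *v X) (P x *v Y)) *\<^sub>R ((1 / (\<beta> x - \<alpha> x)) *\<^sub>R grad G \<alpha> x))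
    \<and> (\<forall>X Y. Sh G P x X Y = ((1/2) * ginner G x (hproj P x *v X) (hproj P x *v Y)) *\<^sub>R ((1 / (\<alpha> x - \<beta> x)) *\<^sub>R grad G \<beta> x)))"
    using sym3_cov_t2_eq_0_iff_umbilic assms(4,5) by simp
  finally show ?thesis
    by (auto intro!: exI)
qed

end
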